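(* For almost all configurations $(w_j)_{j\in\mathbb{Z}}$ of the $\frac12$-discrete sine process, the following holds for all $n\ge1$ and all $\varphi\in\mathcal{S}(\mathbb{R}^n)$: $$\lim_{N\to\infty}\frac1N\sum_{\ell=0}^{N-1}\Bigg(\sum_{\substack{j_1,\dots,j_n\in\mathbb{Z}\\ \text{distinct}}}\varphi\big(w_{j_1}-\tfrac{\ell}{2},\dots,w_{j_n}-\tfrac{\ell}{2}\big)\Bigg)=\big(\tfrac12\big)^n\sum_{k\in(\frac12\mathbb{Z})^n}\varphi(k)\det_{1\le i,j\le n}\big[S(k_i-k_j)\big].$$
   Context: $S(x)=\frac{\sin\pi x}{\pi x}$ for $x\ne0$, $S(0)=1$. $\mathcal{S}(\mathbb{R}^n)$ is the Schwartz space. The $\frac12$-discrete sine process is the point process (random locally finite configuration $(w_j)_{j\in\mathbb{Z}}$ of points) supported on $\frac12\mathbb{Z}$ satisfying, for all $n\ge1$ and $\varphi\in C_c(\mathbb{R}^n)$, $\mathbb{E}\sum_{j_1,\dots,j_n\ \text{distinct}}\varphi(w_{j_1},\dots,w_{j_n})=(\tfrac12)^n\sum_{k\in(\frac12\mathbb{Z})^n}\varphi(k)\det_{1\le i,j\le n}[S(k_i-k_j)]$; it exists and is uniquely determined by these correlation functions. *)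

theory Defs
  imports "HOL-Probability.Probability" "Jordan_Normal_Form.Determinant"
begin

text \<open>
  The dimension \<open>n\<close> is quantified inside the almost-sure statement, so \<open>\<real>\<^sup>n\<close> is the library space
  \<^term>\<open>Euclidean_space n\<close>, whose points are the functions \<open>x :: nat \<Rightarrow> real\<close> with \<open>x i = 0\<close> for
  \<open>i \<ge> n\<close>. Test functions are complex valued; their values off \<^term>\<open>topspace (Euclidean_space n)\<close>
  are irrelevant.
\<close>

definition vec_of :: "nat \<Rightarrow> (nat \<Rightarrow> real) \<Rightarrow> nat \<Rightarrow> real" where
  "vec_of n x = (\<lambda>i. if i < n then x i else 0)"

definition partial_deriv :: "nat \<Rightarrow> ((nat \<Rightarrow> real) \<Rightarrow> complex) \<Rightarrow> (nat \<Rightarrow> real) \<Rightarrow> complex" where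
  "partial_deriv i f = (\<lambda>x. vector_derivative (\<lambda>t. f (x(i := t))) (at (x i)))"

definition iter_partial_deriv ::
    "nat list \<Rightarrow> ((nat \<Rightarrow> real) \<Rightarrow> complex) \<Rightarrow> (nat \<Rightarrow> real) \<Rightarrow> complex" where
  "iter_partial_deriv is f = foldr partial_deriv is f"

definition smooth_fun :: "nat \<Rightarrow> ((nat \<Rightarrow> real) \<Rightarrow> complex) \<Rightarrow> bool" where
  "smooth_fun n f \<longleftrightarrow>
     (\<forall>is \<in> lists {..<n}.
        continuous_map (Euclidean_space n) euclidean (iter_partial_deriv is f) \<and>
        (\<forall>i<n. \<forall>x \<in> topspace (Euclidean_space n).
           (\<lambda>t. iter_partial_deriv is f (x(i := t))) differentiable (at (x i))))"

definition schwartz_space :: "nat \<Rightarrow> ((nat \<Rightarrow> real) \<Rightarrow> complex) set" where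
  "schwartz_space n =
     {f. smooth_fun n f \<and>
         (\<forall>a :: nat \<Rightarrow> nat. \<forall>is \<in> lists {..<n}.
            bounded ((\<lambda>x. (\<Prod>i<n. x i ^ a i) *\<^sub>R iter_partial_deriv is f x)
                       ` topspace (Euclidean_space n)))}"

definition cc_space :: "nat \<Rightarrow> ((nat \<Rightarrow> real) \<Rightarrow> complex) set" where
  "cc_space n =
     {f. continuous_map (Euclidean_space n) euclidean f \<and>
         compactin (Euclidean_space n)
           (Euclidean_space n closure_of {x \<in> topspace (Euclidean_space n). f x \<noteq> 0})}"

definition S :: "real \<Rightarrow> real" where
  "S x = (if x = 0 then 1 else sin (pi * x) / (pi * x))"

definition half_ints :: "real set" where
  "half_ints = range (\<lambda>m::int. real_of_int m / 2)"

definition half_lattice :: "nat \<Rightarrow> (nat \<Rightarrow> real) set" where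
  "half_lattice n = {k \<in> topspace (Euclidean_space n). \<forall>i<n. k i \<in> half_ints}"

definition distinct_indices :: "nat \<Rightarrow> (nat \<Rightarrow> int) set" where
  "distinct_indices n = {j \<in> {..<n} \<rightarrow>\<^sub>E UNIV. inj_on j {..<n}}"

definition sine_det :: "nat \<Rightarrow> (nat \<Rightarrow> real) \<Rightarrow> real" where
  "sine_det n k = Determinant.det (Matrix.mat n n (\<lambda>(i, j). S (k i - k j)))"

text \<open>
  A point process is a random locally finite configuration for which the number of points in every
  bounded Borel set is a random variable. Points are labelled by the integers, repetitions counting
  with multiplicity; no measurability of the labelling itself is required.
\<close>

definition point_process :: "'a measure \<Rightarrow> ('a \<Rightarrow> int \<Rightarrow> real) \<Rightarrow> bool" where
  "point_process M w \<longleftrightarrow>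
     prob_space M \<and>
     (\<forall>\<omega> \<in> space M. \<forall>K. compact K \<longrightarrow> finite {j. w \<omega> j \<in> K}) \<and>
     (\<forall>B \<in> sets borel. bounded B \<longrightarrow>
        (\<lambda>\<omega>. card {j. w \<omega> j \<in> B}) \<in> measurable M (count_space UNIV))"

text \<open>
  \<^const>\<open>has_bochner_integral\<close> states the value of the expectation together with its existence. Both
  inner sums have only finitely many nonzero terms.
\<close>

definition half_discrete_sine_process :: "'a measure \<Rightarrow> ('a \<Rightarrow> int \<Rightarrow> real) \<Rightarrow> bool" where
  "half_discrete_sine_process M w \<longleftrightarrow>
     point_process M w \<and>
     (AE \<omega> in M. \<forall>j. w \<omega> j \<in> half_ints) \<and>
     (\<forall>n\<ge>1. \<forall>\<phi> \<in> cc_space n.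
        has_bochner_integral M
          (\<lambda>\<omega>. \<Sum>\<^sub>\<infinity>j \<in> distinct_indices n. \<phi> (vec_of n (\<lambda>i. w \<omega> (j i))))
          ((1/2) ^ n * (\<Sum>\<^sub>\<infinity>k \<in> half_lattice n. \<phi> k * of_real (sine_det n k))))"

end

theory Submission
  imports Defs
begin

text \<open>
  Testing the correlation identities against tent functions centred at lattice points identifies
  the probability that \<open>n\<close> given sites of \<open>(1/2)\<int>\<close> are all occupied as \<open>2\<^sup>-\<^sup>n det S(k\<^sub>i - k\<^sub>j)\<close>; on the
  diagonal this vanishes for \<open>n = 2\<close>, so the configuration is almost surely simple. The covariance of
  the occupation indicators of two translates of a pattern at distance \<open>d\<close> is the difference between
  the determinant of a \<open>2n \<times> 2n\<close> matrix and that of its block diagonal part, hence \<open>O(1/d)\<close> because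
  \<open>|S(x)| \<le> 1/|x|\<close>. A second moment estimate along \<open>N = k\<^sup>4\<close> and interpolation give the strong law for
  each of the countably many patterns. On such a configuration, every occupation average lies in
  \<open>[0, 1]\<close> and a Schwartz function is summable on the lattice, so dominated convergence yields the
  limit for all \<open>n\<close> and \<open>\<phi>\<close> simultaneously.
\<close>

section \<open>A strong law under decaying correlations\<close>

text \<open>With \<open>s = sqrt (N + 1)\<close>, the inequality of arithmetic and geometric means
  gives \<open>2 * sqrt N * s \<le> 2 * s^2 - 1\<close>, so
  \<open>2 * sqrt N \<le> 2 * s - 1 / s\<close>; and the new term \<open>1 / s^2\<close> is at most
  \<open>1 / s\<close>. The bound is cruder than a logarithm, but any power saving over
  \<open>N\<close> is enough for the strong law.\<close>

lemma sum_inverse_Suc_le_sqrt: "(\<Sum>d<N. 1 / (1 + real d)) \<le> 2 * sqrt (real N)"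
proof (induction N)
  case (Suc N)
  define s where "s = sqrt (real N + 1)"
  have s: "s \<ge> 1" "s * s = real N + 1" by (simp_all add: s_def)
  have "0 \<le> (s - sqrt (real N))\<^sup>2" by simp
  then have "2 * sqrt (real N) * s \<le> 2 * (s * s) - 1"
    using s by (simp add: power2_eq_square algebra_simps)
  then have "2 * sqrt (real N) \<le> (2 * (s * s) - 1) / s"
    using s by (simp add: field_simps)
  moreover have "1 / (1 + real N) \<le> 1 / s"
    using s mult_left_mono[OF s(1), of s] by (intro frac_le) auto
  moreover have "(2 * (s * s) - 1) / s + 1 / s = 2 * s"
    using s by (simp add: field_simps)
  ultimately have "2 * sqrt (real N) + 1 / (1 + real N) \<le> 2 * s" by linarith
  with Suc show ?case by (simp add: s_def add.commute)
qed simp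

text \<open>For fixed \<open>i\<close>, the indices \<open>j\<close> are cut at \<open>i\<close>. On
  each side the distance to \<open>i\<close> determines \<open>j\<close>, so each half is a subsum
  of the harmonic sum bounded above.\<close>

lemma sum_inverse_dist_le:
  "(\<Sum>i<N. \<Sum>j<N. 1 / (1 + \<bar>real i - real j\<bar>)) \<le> 4 * (real N * sqrt (real N))"
proof -
  have aux: "(\<Sum>j\<in>A. 1 / (1 + \<bar>real i - real j\<bar>)) \<le> 2 * sqrt (real N)"
    if "inj_on (\<lambda>j. nat \<bar>int i - int j\<bar>) A" "A \<subseteq> {..<N}" "i < N" for i A
  proof -
    have "(\<Sum>j\<in>A. 1 / (1 + \<bar>real i - real j\<bar>))
          = (\<Sum>j\<in>A. 1 / (1 + real (nat \<bar>int i - int j\<bar>)))"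
      by (rule sum.cong) auto
    also have "\<dots> = (\<Sum>d\<in>(\<lambda>j. nat \<bar>int i - int j\<bar>) ` A. 1 / (1 + real d))"
      by (simp add: sum.reindex[OF that(1)])
    also have "\<dots> \<le> (\<Sum>d<N. 1 / (1 + real d))"
      using that by (intro sum_mono2) auto
    also have "\<dots> \<le> 2 * sqrt (real N)" by (rule sum_inverse_Suc_le_sqrt)
    finally show ?thesis .
  qed
  have "(\<Sum>j<N. 1 / (1 + \<bar>real i - real j\<bar>)) \<le> 4 * sqrt (real N)" if i: "i < N" for i
  proof -
    have split: "{..<N} = {..i} \<union> {i<..<N}" using i by auto
    have "(\<Sum>j<N. 1 / (1 + \<bar>real i - real j\<bar>)) =
      (\<Sum>j\<in>{..i}. 1 / (1 + \<bar>real i - real j\<bar>)) + (\<Sum>j\<in>{i<..<N}. 1 / (1 + \<bar>real i - real j\<bar>))"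
      unfolding split by (subst sum.union_disjoint) auto
    also have "\<dots> \<le> 2 * sqrt (real N) + 2 * sqrt (real N)"
      using i by (intro add_mono aux) (auto simp: inj_on_def)
    finally show ?thesis by simp
  qed
  then have "(\<Sum>i<N. \<Sum>j<N. 1 / (1 + \<bar>real i - real j\<bar>)) \<le> (\<Sum>i<N. 4 * sqrt (real N))"
    by (intro sum_mono) auto
  then show ?thesis by (simp add: algebra_simps)
qed

text \<open>Consecutive fourth powers have ratio tending to 1, so the terms between
  \<open>k^4\<close> and \<open>(k + 1)^4\<close>, each bounded by \<open>B\<close>, change the
  average by at most \<open>B * ((1 + 1 / k)^4 - 1)\<close>, which tends to 0.\<close>

lemma averages_tendsto_zero_of_fourth_powers:
  fixes z :: "nat \<Rightarrow> real"
  assumes bdd: "\<And>i. \<bar>z i\<bar> \<le> B"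
    and sub: "(\<lambda>k. (\<Sum>i<Suc k ^ 4. z i) / real (Suc k ^ 4)) \<longlonglongrightarrow> 0"
  shows "(\<lambda>N. (\<Sum>i<N. z i) / real N) \<longlonglongrightarrow> 0"
proof -
  have B: "B \<ge> 0" using bdd[of 0] by linarith
  \<comment> \<open>For \<open>N \<ge> 1\<close>, \<open>Suc (r N)\<close> is the base of the
    largest fourth power not exceeding \<open>N\<close>. The subtraction matches the indexing by
    \<open>Suc k ^ 4\<close>, which keeps the denominators nonzero.\<close>
  define r where "r N = nat \<lfloor>root 4 (real N)\<rfloor> - 1" for N :: nat
  have r: "Suc (r N) ^ 4 \<le> N \<and> N < (Suc (r N) + 1) ^ 4" if "N \<ge> 1" for N
  proof -
    have "root 4 (real N) \<ge> 1" using that by simp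
    then have R: "real (Suc (r N)) \<le> root 4 (real N)" "root 4 (real N) < real (Suc (r N)) + 1"
      unfolding r_def by linarith+
    have "real (Suc (r N)) ^ 4 \<le> root 4 (real N) ^ 4" by (intro power_mono R) auto
    moreover have "root 4 (real N) ^ 4 < (real (Suc (r N)) + 1) ^ 4"
      using R by (intro power_strict_mono) auto
    ultimately have "real (Suc (r N) ^ 4) \<le> real N" "real N < real ((Suc (r N) + 1) ^ 4)"
      by simp_all
    then show ?thesis by (simp only: of_nat_le_iff of_nat_less_iff)
  qed
  have r_lim: "filterlim r at_top sequentially"
    unfolding filterlim_at_top
  proof
    fix Z
    show "eventually (\<lambda>N. Z \<le> r N) sequentially"
      using eventually_ge_at_top[of "(Z + 2) ^ 4"]
    proof eventually_elim
      case (elim N)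
      have "N \<ge> 1" using elim by (metis One_nat_def Suc_leI add_gr_0 le_trans zero_less_power zero_less_numeral)
      from r[OF this] have "(Z + 2) ^ 4 < (Suc (r N) + 1) ^ 4" using elim by linarith
      then have "Z + 2 < Suc (r N) + 1" by (rule power_less_imp_less_base) simp
      then show ?case by simp
    qed
  qed
  have gap: "(\<lambda>k. \<bar>(\<Sum>i<Suc k ^ 4. z i) / real (Suc k ^ 4)\<bar>
                  + B * ((1 + 1 / real (Suc k)) ^ 4 - 1)) \<longlonglongrightarrow> 0 + B * ((1 + 0) ^ 4 - 1)"
    by (intro tendsto_intros tendsto_rabs_zero sub) (rule LIMSEQ_Suc, rule lim_1_over_n)
  have "eventually (\<lambda>N. norm ((\<Sum>i<N. z i) / real N) \<le>
      \<bar>(\<Sum>i<Suc (r N) ^ 4. z i) / real (Suc (r N) ^ 4)\<bar>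
        + B * ((1 + 1 / real (Suc (r N))) ^ 4 - 1)) sequentially"
    using eventually_ge_at_top[of 1]
  proof eventually_elim
    case (elim N)
    define k where "k = Suc (r N)"
    define K where "K = k ^ 4"
    have K: "K \<le> N" "N \<le> (k + 1) ^ 4" "K > 0" "k > 0"
      using r[OF elim] by (auto simp: K_def k_def)
    have "(\<Sum>i<N. z i) = (\<Sum>i<K. z i) + (\<Sum>i=K..<N. z i)"
      using sum.atLeastLessThan_concat[of 0 K N z] K by (simp add: lessThan_atLeast0)
    moreover have "\<bar>\<Sum>i=K..<N. z i\<bar> \<le> (\<Sum>i=K..<N. B)"
      by (rule order_trans[OF sum_abs]) (intro sum_mono bdd)
    moreover have "(\<Sum>i=K..<N. B) \<le> B * (real ((k + 1) ^ 4) - real K)"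
    proof -
      have "real (N - K) \<le> real ((k + 1) ^ 4) - real K"
        using K(1,2) of_nat_mono[OF K(2), where 'a = real] by (simp add: of_nat_diff)
      then have "B * real (N - K) \<le> B * (real ((k + 1) ^ 4) - real K)"
        by (rule mult_left_mono[OF _ B])
      then show ?thesis by (simp add: mult.commute)
    qed
    ultimately have "\<bar>\<Sum>i<N. z i\<bar> \<le> \<bar>\<Sum>i<K. z i\<bar> + B * (real ((k + 1) ^ 4) - real K)"
      by linarith
    then have "\<bar>\<Sum>i<N. z i\<bar> / real N \<le> (\<bar>\<Sum>i<K. z i\<bar> + B * (real ((k + 1) ^ 4) - real K)) / real K"
      using K(1,3) by (intro frac_le) auto
    also have "\<dots> = \<bar>\<Sum>i<K. z i\<bar> / real K + B * (real ((k + 1) ^ 4) / real K - 1)"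
      using K by (simp add: field_simps)
    also have "real ((k + 1) ^ 4) / real K = (1 + 1 / real k) ^ 4"
    proof -
      have "(1 + 1 / real k) = (real k + 1) / real k" using K by (simp add: field_simps)
      then show ?thesis by (simp add: K_def power_divide add.commute)
    qed
    finally show ?case by (simp add: K_def k_def abs_divide)
  qed
  then show ?thesis
    by (rule Lim_null_comparison)
       (use filterlim_compose[OF gap r_lim] in simp)
qed

text \<open>By \<open>sum_inverse_dist_le\<close>, the average of the first \<open>N\<close>
  variables has second moment at most \<open>4 * C / sqrt N\<close>. Along
  \<open>N = (k + 1)^4\<close> this is \<open>4 * C / (k + 1)^2\<close>, which is summable in
  \<open>k\<close>; the boundedness of the variables then fills the gaps between fourth
  powers.\<close>

lemma (in prob_space) strong_law_decaying_correlations: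
  fixes Z :: "nat \<Rightarrow> 'a \<Rightarrow> real"
  assumes meas [measurable]: "\<And>i. Z i \<in> borel_measurable M"
    and bdd: "\<And>i. AE x in M. \<bar>Z i x\<bar> \<le> B"
    and corr: "\<And>i j. expectation (\<lambda>x. Z i x * Z j x) \<le> C / (1 + \<bar>real i - real j\<bar>)"
  shows "AE x in M. (\<lambda>N. (\<Sum>i<N. Z i x) / real N) \<longlonglongrightarrow> 0"
proof -
  have "0 \<le> expectation (\<lambda>x. Z 0 x * Z 0 x)" by (intro integral_nonneg_AE) auto
  also have "\<dots> \<le> C" using corr[of 0 0] by simp
  finally have C: "C \<ge> 0" .
  have int: "integrable M (\<lambda>x. Z i x * Z j x)" for i j
  proof (rule integrable_const_bound[where B = "\<bar>B\<bar> * \<bar>B\<bar>"])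
    show "AE x in M. norm (Z i x * Z j x) \<le> \<bar>B\<bar> * \<bar>B\<bar>"
      using bdd[of i] bdd[of j]
      by eventually_elim (auto simp: abs_mult intro!: mult_mono)
  qed simp
  define A where "A k x = (\<Sum>i<Suc k ^ 4. Z i x) / real (Suc k ^ 4)" for k x
  have [measurable]: "A k \<in> borel_measurable M" for k unfolding A_def by measurable
  have sq: "(A k x)\<^sup>2 = (\<Sum>i<Suc k ^ 4. \<Sum>j<Suc k ^ 4. Z i x * Z j x) / real (Suc k) ^ 8" for k x
    unfolding A_def by (simp add: power_divide power2_eq_square sum_product flip: power_add)
  have intA: "integrable M (\<lambda>x. (A k x)\<^sup>2)" for k
    unfolding sq by (intro integrable_divide_zero Bochner_Integration.integrable_sum int) 
  have EA: "expectation (\<lambda>x. (A k x)\<^sup>2) \<le> 4 * C * (1 / real (Suc k) ^ 2)" for k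
  proof -
    let ?N = "Suc k ^ 4"
    have "expectation (\<lambda>x. (A k x)\<^sup>2)
        = (\<Sum>i<?N. \<Sum>j<?N. expectation (\<lambda>x. Z i x * Z j x)) / real (Suc k) ^ 8"
      unfolding sq by (simp add: int Bochner_Integration.integral_sum)
    also have "\<dots> \<le> (\<Sum>i<?N. \<Sum>j<?N. C * (1 / (1 + \<bar>real i - real j\<bar>))) / real (Suc k) ^ 8"
      using corr by (intro divide_right_mono sum_mono) auto
    also have "\<dots> = C * (\<Sum>i<?N. \<Sum>j<?N. 1 / (1 + \<bar>real i - real j\<bar>)) / real (Suc k) ^ 8"
      by (simp only: sum_distrib_left)
    also have "\<dots> \<le> C * (4 * (real ?N * sqrt (real ?N))) / real (Suc k) ^ 8"
      by (intro divide_right_mono mult_left_mono sum_inverse_dist_le C) auto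
    also have "sqrt (real ?N) = real (Suc k) ^ 2"
      by (rule real_sqrt_unique) (simp_all flip: power_mult)
    also have "C * (4 * (real ?N * real (Suc k) ^ 2)) / real (Suc k) ^ 8 = 4 * C * (1 / real (Suc k) ^ 2)"
    proof -
      have "real (Suc k) ^ 8 = real ?N * real (Suc k) ^ 2 * real (Suc k) ^ 2"
        by (simp flip: power_add)
      moreover have "real ?N * real (Suc k) ^ 2 \<noteq> 0" by simp
      ultimately show ?thesis by (simp add: divide_simps del: of_nat_Suc of_nat_power)
    qed
    finally show ?thesis .
  qed
  have summ: "summable (\<lambda>k. 4 * C * (1 / real (Suc k) ^ 2))"
    using inverse_squares_sums by (intro summable_mult) (auto simp: sums_iff add.commute)
  \<comment> \<open>Exchanging sum and integral takes the place of Chebyshev and Borel-Cantelli: the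
    series of squared averages has finite expectation, so it converges almost surely and its terms
    tend to 0.\<close>
  have "(\<integral>\<^sup>+x. (\<Sum>k. ennreal ((A k x)\<^sup>2)) \<partial>M) = (\<Sum>k. \<integral>\<^sup>+x. ennreal ((A k x)\<^sup>2) \<partial>M)"
    by (rule nn_integral_suminf) measurable
  also have "\<dots> = (\<Sum>k. ennreal (expectation (\<lambda>x. (A k x)\<^sup>2)))"
    by (intro suminf_cong nn_integral_eq_integral intA) auto
  also have "\<dots> \<le> (\<Sum>k. ennreal (4 * C * (1 / real (Suc k) ^ 2)))"
    by (intro suminf_le ennreal_leI EA) auto
  also have "\<dots> = ennreal (\<Sum>k. 4 * C * (1 / real (Suc k) ^ 2))"
    using C by (intro suminf_ennreal2 summ) auto
  also have "\<dots> < \<infinity>" by simp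
  finally have "AE x in M. (\<Sum>k. ennreal ((A k x)\<^sup>2)) \<noteq> \<infinity>"
    by (intro nn_integral_PInf_AE) auto
  moreover have "AE x in M. \<forall>i. \<bar>Z i x\<bar> \<le> B"
    using bdd by (simp add: AE_all_countable)
  ultimately show ?thesis
  proof eventually_elim
    case (elim x)
    have "summable (\<lambda>k. (A k x)\<^sup>2)"
      by (rule summable_suminf_not_top) (use elim in auto)
    then have "(\<lambda>k. (A k x)\<^sup>2) \<longlonglongrightarrow> 0" by (rule summable_LIMSEQ_zero)
    then have "(\<lambda>k. A k x) \<longlonglongrightarrow> 0" by (simp add: power_tendsto_0_iff)
    then show ?case
      using elim by (intro averages_tendsto_zero_of_fourth_powers[of _ B]) (auto simp: A_def)
  qed
qed

section \<open>Determinants of the sine kernel\<close>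

text \<open>In the Leibniz expansion each of the \<open>n!\<close> products has \<open>n\<close>
  factors of modulus at most 1. Replacing the factors one at a time changes such a product by at
  most the sum of the entrywise differences.\<close>

lemma abs_det_diff_le:
  fixes A B :: "real mat"
  assumes A: "A \<in> carrier_mat n n" and B: "B \<in> carrier_mat n n"
    and A1: "\<And>i j. i < n \<Longrightarrow> j < n \<Longrightarrow> \<bar>A $$ (i, j)\<bar> \<le> 1"
    and B1: "\<And>i j. i < n \<Longrightarrow> j < n \<Longrightarrow> \<bar>B $$ (i, j)\<bar> \<le> 1"
    and close: "\<And>i j. i < n \<Longrightarrow> j < n \<Longrightarrow> \<bar>A $$ (i, j) - B $$ (i, j)\<bar> \<le> \<delta>"
  shows "\<bar>Determinant.det A - Determinant.det B\<bar> \<le> fact n * (real n * \<delta>)"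
proof -
  let ?P = "{p. p permutes {0..<n}}"
  have perm: "p i < n" if "p \<in> ?P" "i < n" for p i
    using that permutes_in_image[of p "{0..<n}" i] by auto
  have "\<bar>signof p * (\<Prod>i=0..<n. A $$ (i, p i)) - signof p * (\<Prod>i=0..<n. B $$ (i, p i))\<bar>
        \<le> real n * \<delta>" if p: "p \<in> ?P" for p
  proof -
    have "\<bar>signof p * (\<Prod>i=0..<n. A $$ (i, p i)) - signof p * (\<Prod>i=0..<n. B $$ (i, p i))\<bar>
        = \<bar>(\<Prod>i=0..<n. A $$ (i, p i)) - (\<Prod>i=0..<n. B $$ (i, p i))\<bar>"
      by (simp add: sign_def abs_minus_commute)
    also have "\<dots> \<le> (\<Sum>i=0..<n. \<bar>A $$ (i, p i) - B $$ (i, p i)\<bar>)"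
      using norm_prod_diff[of "{0..<n}" "\<lambda>i. A $$ (i, p i)" "\<lambda>i. B $$ (i, p i)"]
        A1 B1 perm[OF p] by simp
    also have "\<dots> \<le> (\<Sum>i=0..<n. \<delta>)"
      using perm[OF p] by (intro sum_mono close) auto
    finally show ?thesis by simp
  qed
  then have "(\<Sum>p\<in>?P. \<bar>signof p * (\<Prod>i=0..<n. A $$ (i, p i)) - signof p * (\<Prod>i=0..<n. B $$ (i, p i))\<bar>)
      \<le> (\<Sum>p\<in>?P. real n * \<delta>)"
    by (rule sum_mono)
  also have "\<dots> = fact n * (real n * \<delta>)"
    using card_permutations[of "{0..<n}" n] by simp
  finally have *: "(\<Sum>p\<in>?P. \<bar>signof p * (\<Prod>i=0..<n. A $$ (i, p i)) - signof p * (\<Prod>i=0..<n. B $$ (i, p i))\<bar>)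
      \<le> fact n * (real n * \<delta>)" .
  show ?thesis
    unfolding det_def'[OF A] det_def'[OF B] sum_subtractf[symmetric]
    by (rule order_trans[OF sum_abs *])
qed

section \<open>Symmetry and decay of the sine kernel\<close>

lemma S_minus: "S (- x) = S x"
  by (simp add: S_def)

lemma abs_S_le_1: "\<bar>S x\<bar> \<le> 1"
  using abs_sin_x_le_abs_x[of "pi * x"] by (simp add: S_def divide_le_eq)

lemma abs_S_le_inverse:
  assumes "x \<noteq> 0"
  shows "\<bar>S x\<bar> \<le> 1 / \<bar>x\<bar>"
proof -
  have "\<bar>sin (pi * x)\<bar> / \<bar>pi * x\<bar> \<le> 1 / \<bar>x\<bar>"
  proof (rule frac_le)
    have "1 * \<bar>x\<bar> \<le> pi * \<bar>x\<bar>" using pi_gt3 by (intro mult_right_mono) auto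
    then show "\<bar>x\<bar> \<le> \<bar>pi * x\<bar>" by (simp add: abs_mult)
  qed (use assms in auto)
  then show ?thesis using assms by (simp add: S_def)
qed

text \<open>No cutoff at \<open>n + n\<close> is imposed: for \<open>m\<close> in
  \<open>half_lattice n\<close> the tail \<open>m (i - n)\<close> already vanishes, so the result is
  a point of the lattice in dimension \<open>n + n\<close>.\<close>

definition concat_points :: "nat \<Rightarrow> (nat \<Rightarrow> real) \<Rightarrow> (nat \<Rightarrow> real) \<Rightarrow> nat \<Rightarrow> real" where
  "concat_points n k m = (\<lambda>i. if i < n then k i else m (i - n))"

text \<open>The kernel sees only differences of points. This makes the occupation probabilities of
  patterns invariant under shifts.\<close>

lemma sine_det_translate:
  assumes "\<And>i. i < n \<Longrightarrow> m i = k i + c"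
  shows "sine_det n m = sine_det n k"
  unfolding sine_det_def by (rule arg_cong[of _ _ Determinant.det]) (auto simp: assms)

text \<open>The product of the two determinants is the determinant of a block diagonal matrix. The
  diagonal blocks agree exactly with those of the concatenated pattern, and the off-diagonal blocks
  consist of values of \<open>S\<close> at differences between the two patterns, so
  \<open>abs_det_diff_le\<close> applies in size \<open>n + n\<close>.\<close>

lemma sine_det_concat_points:
  assumes "\<And>a b. a < n \<Longrightarrow> b < n \<Longrightarrow> \<bar>S (k a - m b)\<bar> \<le> \<delta>" "\<delta> \<ge> 0"
  shows "\<bar>sine_det (n + n) (concat_points n k m) - sine_det n k * sine_det n m\<bar>
         \<le> fact (n + n) * (real (n + n) * \<delta>)"
proof -
  define Q where "Q p = Matrix.mat n n (\<lambda>(i, j). S (p i - p j))" for p :: "nat \<Rightarrow> real"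
  define B where "B = four_block_mat (Q k) (0\<^sub>m n n) (0\<^sub>m n n) (Q m)"
  have Q: "Q p \<in> carrier_mat n n" for p by (simp add: Q_def)
  have B: "B \<in> carrier_mat (n + n) (n + n)" by (simp add: B_def Q_def)
  have "sine_det n k * sine_det n m = Determinant.det B"
    unfolding B_def sine_det_def Q_def[symmetric]
    by (subst det_four_block_mat_upper_right_zero[OF Q refl _ Q]) auto
  moreover have ent: "B $$ (i, j) = (if i < n then if j < n then S (k i - k j) else 0
      else if j < n then 0 else S (m (i - n) - m (j - n)))" if "i < n + n" "j < n + n" for i j
    using that by (auto simp: B_def Q_def)
  \<comment> \<open>The hypothesis covers the upper right block; evenness of \<open>S\<close>
    carries it to the lower left one.\<close>
  have "\<bar>S (concat_points n k m i - concat_points n k m j) - B $$ (i, j)\<bar> \<le> \<delta>"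
    if "i < n + n" "j < n + n" for i j
    using that assms(1)[of i "j - n"] assms(1)[of j "i - n"] assms(2)
      S_minus[of "m (i - n) - k j"]
    by (auto simp: ent concat_points_def)
  then have "\<bar>sine_det (n + n) (concat_points n k m) - Determinant.det B\<bar>
         \<le> fact (n + n) * (real (n + n) * \<delta>)"
    unfolding sine_det_def
    by (intro abs_det_diff_le B) (auto simp: abs_S_le_1 ent)
  ultimately show ?thesis by simp
qed

section \<open>Lattice configurations\<close>

text \<open>A product of tents whose half-width equals the lattice spacing \<open>1/2\<close>:
  continuous and compactly supported, as a test function must be, yet on
  \<open>half_lattice n\<close> exactly the indicator of \<open>m\<close>.\<close>

definition bump :: "nat \<Rightarrow> (nat \<Rightarrow> real) \<Rightarrow> (nat \<Rightarrow> real) \<Rightarrow> real" where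
  "bump n m x = (\<Prod>i<n. max 0 (1 - 2 * \<bar>x i - m i\<bar>))"

lemma bump_nonneg: "bump n m x \<ge> 0"
  by (auto simp: bump_def intro!: prod_nonneg)

lemma bump_nonzeroD:
  assumes "bump n m x \<noteq> 0" "i < n"
  shows "\<bar>x i - m i\<bar> < 1/2"
proof -
  have "max 0 (1 - 2 * \<bar>x i - m i\<bar>) \<noteq> 0" using assms by (auto simp: bump_def)
  then show ?thesis by (simp add: max_def split: if_splits)
qed

lemma bump_in_cc_space: "(\<lambda>x. complex_of_real (bump n m x)) \<in> cc_space n"
proof -
  let ?E = "Euclidean_space n"
  have proj: "continuous_map ?E euclideanreal (\<lambda>x. x i)" for i
    unfolding Euclidean_space_def
    by (intro continuous_map_from_subtopology continuous_map_product_coordinates) auto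
  have cont: "continuous_map ?E euclideanreal (bump n m)"
    unfolding bump_def
    by (intro continuous_map_prod continuous_intros proj) auto
  have "continuous_map ?E euclidean (\<lambda>x. complex_of_real (bump n m x))"
    using continuous_map_compose[OF cont, of euclidean complex_of_real]
    by (simp add: o_def continuous_on_of_real)
  moreover have "compactin ?E (?E closure_of {x \<in> topspace ?E. complex_of_real (bump n m x) \<noteq> 0})"
  proof -
    \<comment> \<open>A closed box with the coordinates from \<open>n\<close> on pinned to 0:
      compact by Tychonoff and contained in the Euclidean space. Being closed in a Hausdorff space,
      it contains the closure of the nonvanishing set.\<close>
    define K where "K = PiE UNIV (\<lambda>i. if i < n then {m i - 1/2..m i + 1/2} else {0})"
    have K: "K \<subseteq> topspace ?E" by (auto simp: K_def topspace_Euclidean_space PiE_iff split: if_splits)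
    have "compactin (powertop_real UNIV) K"
      unfolding K_def by (subst compactin_PiE) auto
    then have cK: "compactin ?E K"
      using K by (simp add: Euclidean_space_def compactin_subtopology topspace_Euclidean_space)
    have "Hausdorff_space ?E"
      unfolding Euclidean_space_def
      by (intro Hausdorff_space_subtopology) (simp add: Hausdorff_space_product_topology)
    then have "closedin ?E K" using cK by (rule compactin_imp_closedin)
    moreover have "{x \<in> topspace ?E. complex_of_real (bump n m x) \<noteq> 0} \<subseteq> K"
    proof
      fix x assume x: "x \<in> {x \<in> topspace ?E. complex_of_real (bump n m x) \<noteq> 0}"
      have "x i \<in> {m i - 1/2..m i + 1/2}" if "i < n" for i
      proof -
        have "\<bar>x i - m i\<bar> < 1/2" using bump_nonzeroD[OF _ that, of m x] x by auto
        then show ?thesis unfolding atLeastAtMost_iff by linarith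
      qed
      then show "x \<in> K" using x by (auto simp: K_def topspace_Euclidean_space PiE_iff)
    qed
    ultimately have "?E closure_of {x \<in> topspace ?E. complex_of_real (bump n m x) \<noteq> 0} \<subseteq> K"
      by (rule closure_of_minimal[rotated])
    then show ?thesis using cK closed_compactin closedin_closure_of by blast
  qed
  ultimately show ?thesis by (simp add: cc_space_def)
qed

lemma half_ints_dist:
  assumes "a \<in> half_ints" "b \<in> half_ints" "\<bar>a - b\<bar> < 1/2"
  shows "a = b"
proof -
  from assms obtain p q where pq: "a = real_of_int p / 2" "b = real_of_int q / 2"
    by (auto simp: half_ints_def)
  with assms(3) have "\<bar>real_of_int p - real_of_int q\<bar> < 1" by linarith
  then have "\<bar>p - q\<bar> < 1" by linarith
  then show ?thesis by (simp add: pq)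
qed

lemma bump_half_lattice:
  assumes "m \<in> half_lattice n" "k \<in> half_lattice n"
  shows "bump n m k = of_bool (k = m)"
proof (cases "bump n m k = 0")
  case True
  have "bump n m m = 1" by (simp add: bump_def)
  with True show ?thesis by auto
next
  case False
  have "k i = m i" for i
  proof (cases "i < n")
    case True
    then show ?thesis
      using bump_nonzeroD[OF False True] assms half_ints_dist by (auto simp: half_lattice_def)
  next
    case False
    then show ?thesis using assms by (auto simp: half_lattice_def topspace_Euclidean_space)
  qed
  then have "k = m" by auto
  then show ?thesis by (simp add: bump_def)
qed

section \<open>Shifts and countability of the lattice\<close>

lemma half_ints_add_half_nat: "x \<in> half_ints \<Longrightarrow> x + real l / 2 \<in> half_ints"
proof -
  assume "x \<in> half_ints"
  then obtain m where "x = real_of_int m / 2" by (auto simp: half_ints_def)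
  then have "x + real l / 2 = real_of_int (m + int l) / 2" by (simp add: field_simps)
  then show ?thesis unfolding half_ints_def by blast
qed

lemma half_ints_diff_half_nat: "x \<in> half_ints \<Longrightarrow> x - real l / 2 \<in> half_ints"
proof -
  assume "x \<in> half_ints"
  then obtain m where "x = real_of_int m / 2" by (auto simp: half_ints_def)
  then have "x - real l / 2 = real_of_int (m - int l) / 2" by (simp add: field_simps)
  then show ?thesis unfolding half_ints_def by blast
qed

lemma vec_of_in_half_lattice:
  "(\<And>i. i < n \<Longrightarrow> x i \<in> half_ints) \<Longrightarrow> vec_of n x \<in> half_lattice n"
  by (auto simp: half_lattice_def vec_of_def topspace_Euclidean_space)

text \<open>Countability allows the null sets attached to the individual patterns to be united into
  one.\<close>

lemma countable_half_lattice: "countable (half_lattice n)"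
proof -
  have "half_lattice n \<subseteq> vec_of n ` (PiE {..<n} (\<lambda>_. half_ints))"
  proof
    fix k assume k: "k \<in> half_lattice n"
    then have "k = vec_of n (restrict k {..<n})"
      by (auto simp: half_lattice_def vec_of_def topspace_Euclidean_space)
    moreover have "restrict k {..<n} \<in> PiE {..<n} (\<lambda>_. half_ints)"
      using k by (auto simp: half_lattice_def)
    ultimately show "k \<in> vec_of n ` (PiE {..<n} (\<lambda>_. half_ints))" by blast
  qed
  moreover have "countable (PiE {..<n} (\<lambda>_. half_ints))"
    by (intro countable_PiE) (auto simp: half_ints_def)
  ultimately show ?thesis by (meson countable_image countable_subset)
qed

text \<open>Distinctness is imposed on the labels, not on the coordinates of \<open>k\<close>. For
  injective \<open>w\<close> both amount to the same, by \<open>occupied_iff\<close>, so a pattern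
  with a repeated site is never occupied, in accordance with the vanishing of its
  determinant.\<close>

definition occupied :: "(int \<Rightarrow> real) \<Rightarrow> nat \<Rightarrow> (nat \<Rightarrow> real) \<Rightarrow> bool" where
  "occupied w n k \<longleftrightarrow> (\<exists>j\<in>distinct_indices n. vec_of n (\<lambda>i. w (j i)) = k)"

lemma inj_on_vec_of_distinct_indices:
  assumes "inj w"
  shows "inj_on (\<lambda>j. vec_of n (\<lambda>i. w (j i) + c)) (distinct_indices n)"
proof (rule inj_onI)
  fix j j' assume j: "j \<in> distinct_indices n" "j' \<in> distinct_indices n"
    and eq: "vec_of n (\<lambda>i. w (j i) + c) = vec_of n (\<lambda>i. w (j' i) + c)"
  have "j i = j' i" if "i < n" for i
    using fun_cong[OF eq, of i] that assms by (auto simp: vec_of_def inj_def)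
  with j show "j = j'"
    unfolding distinct_indices_def by (intro PiE_ext[of _ "{..<n}" "\<lambda>_. UNIV"]) auto
qed

lemma occupied_iff:
  assumes "inj w" "k \<in> topspace (Euclidean_space n)"
  shows "occupied w n k \<longleftrightarrow> inj_on k {..<n} \<and> k ` {..<n} \<subseteq> range w"
proof
  assume "occupied w n k"
  then obtain j where j: "j \<in> distinct_indices n" "vec_of n (\<lambda>i. w (j i)) = k"
    by (auto simp: occupied_def)
  then have "k i = w (j i)" if "i < n" for i using that by (auto simp: vec_of_def)
  then show "inj_on k {..<n} \<and> k ` {..<n} \<subseteq> range w"
    using j(1) assms(1) by (auto simp: distinct_indices_def inj_on_def)
next
  assume *: "inj_on k {..<n} \<and> k ` {..<n} \<subseteq> range w"
  then have "\<forall>i\<in>{..<n}. \<exists>a. k i = w a" by auto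
  then obtain j where j: "\<And>i. i < n \<Longrightarrow> k i = w (j i)" by (metis lessThan_iff)
  have "restrict j {..<n} \<in> distinct_indices n"
    using * j by (auto simp: distinct_indices_def inj_on_def)
  moreover have "vec_of n (\<lambda>i. w (restrict j {..<n} i)) = k"
    using assms(2) j by (auto simp: vec_of_def topspace_Euclidean_space)
  ultimately show "occupied w n k" unfolding occupied_def by blast
qed

lemma concat_points_in_half_lattice:
  "k \<in> half_lattice n \<Longrightarrow> m \<in> half_lattice n \<Longrightarrow> concat_points n k m \<in> half_lattice (n + n)"
  by (auto simp: half_lattice_def concat_points_def topspace_Euclidean_space)

lemma half_lattice_topspace: "k \<in> half_lattice n \<Longrightarrow> k \<in> topspace (Euclidean_space n)"
  by (simp add: half_lattice_def)

text \<open>For patterns without common sites, both conditions of \<open>occupied_iff\<close>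
  decouple: the image of the concatenation is the union of the two images, and it is injective
  exactly when both parts are. A shared site would break the latter.\<close>

lemma occupied_concat_points:
  assumes w: "inj w" and k: "k \<in> half_lattice n" and m: "m \<in> half_lattice n"
    and disj: "\<And>a b. a < n \<Longrightarrow> b < n \<Longrightarrow> k a \<noteq> m b"
  shows "occupied w (n + n) (concat_points n k m) \<longleftrightarrow> occupied w n k \<and> occupied w n m"
proof -
  have img: "concat_points n k m ` {..<n + n} = k ` {..<n} \<union> m ` {..<n}"
  proof -
    have "m b \<in> concat_points n k m ` {..<n + n}" if "b < n" for b
      using that by (intro image_eqI[of _ _ "n + b"]) (auto simp: concat_points_def)
    moreover have "k b \<in> concat_points n k m ` {..<n + n}" if "b < n" for b
      using that by (intro image_eqI[of _ _ b]) (auto simp: concat_points_def)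
    ultimately show ?thesis by (auto simp: concat_points_def)
  qed
  have "inj_on (concat_points n k m) {..<n + n} \<longleftrightarrow> inj_on k {..<n} \<and> inj_on m {..<n}"
  proof (intro iffI conjI)
    assume inj: "inj_on (concat_points n k m) {..<n + n}"
    show "inj_on k {..<n}"
    proof (rule inj_onI)
      fix a b assume "a \<in> {..<n}" "b \<in> {..<n}" "k a = k b"
      then show "a = b" using inj_onD[OF inj, of a b] by (auto simp: concat_points_def)
    qed
    show "inj_on m {..<n}"
    proof (rule inj_onI)
      fix a b assume "a \<in> {..<n}" "b \<in> {..<n}" "m a = m b"
      then show "a = b" using inj_onD[OF inj, of "n + a" "n + b"] by (auto simp: concat_points_def)
    qed
  next
    assume inj: "inj_on k {..<n} \<and> inj_on m {..<n}"
    show "inj_on (concat_points n k m) {..<n + n}"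
    proof (rule inj_onI)
      fix a b assume ab: "a \<in> {..<n + n}" "b \<in> {..<n + n}"
        and eq: "concat_points n k m a = concat_points n k m b"
      have "a < n \<longleftrightarrow> b < n"
      proof (rule ccontr)
        assume "\<not> ?thesis"
        then consider "a < n" "\<not> b < n" "b - n < n" | "b < n" "\<not> a < n" "a - n < n"
          using ab by fastforce
        then show False
          using eq disj[of a "b - n"] disj[of b "a - n"] by cases (auto simp: concat_points_def)
      qed
      moreover have "a - n < n" "b - n < n" if "\<not> a < n" "\<not> b < n" using ab that by auto
      ultimately consider "a < n" "b < n" | "n \<le> a" "n \<le> b" "a - n < n" "b - n < n"
        by (meson not_le)
      then show "a = b"
      proof cases
        case 1
        then show ?thesis using eq inj by (auto simp: concat_points_def dest: inj_onD)
      next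
        case 2
        then have "a - n = b - n" using eq inj by (auto simp: concat_points_def dest: inj_onD)
        then show ?thesis using 2 by simp
      qed
    qed
  qed
  then show ?thesis
    unfolding occupied_iff[OF w half_lattice_topspace[OF k]] occupied_iff[OF w half_lattice_topspace[OF m]]
      occupied_iff[OF w half_lattice_topspace[OF concat_points_in_half_lattice[OF k m]]] img
    by blast
qed

text \<open>All points lie on the lattice, so each summand is 0 or 1, and injectivity of
  \<open>w\<close> leaves at most one label tuple that hits \<open>m\<close>.\<close>

lemma infsum_bump_occupied:
  assumes w: "inj w" "\<And>j. w j \<in> half_ints" and m: "m \<in> half_lattice n"
  shows "(\<Sum>\<^sub>\<infinity>j\<in>distinct_indices n. complex_of_real (bump n m (vec_of n (\<lambda>i. w (j i)))))
         = of_bool (occupied w n m)"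
proof -
  let ?v = "\<lambda>j. vec_of n (\<lambda>i. w (j i))"
  have v: "complex_of_real (bump n m (?v j)) = of_bool (?v j = m)" for j
    using w(2) by (subst bump_half_lattice[OF m]) (auto intro!: vec_of_in_half_lattice)
  show ?thesis
  proof (cases "occupied w n m")
    case True
    then obtain j0 where j0: "j0 \<in> distinct_indices n" "?v j0 = m" by (auto simp: occupied_def)
    have "?v j \<noteq> m" if "j \<in> distinct_indices n - {j0}" for j
      using inj_onD[OF inj_on_vec_of_distinct_indices[OF w(1), of n 0], of j j0] j0 that by auto
    then have "((\<lambda>j. of_bool (?v j = m)) has_sum (1::complex)) (distinct_indices n)"
      using j0 by (intro has_sum_finite_neutralI[of "{j0}"]) auto
    then show ?thesis using True by (simp add: v infsumI)
  next
    case False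
    then show ?thesis
      unfolding v by (subst infsum_cong[where g = "\<lambda>_. 0"]) (auto simp: occupied_def)
  qed
qed

lemma infsum_bump_half_lattice:
  assumes m: "m \<in> half_lattice n"
  shows "(\<Sum>\<^sub>\<infinity>k\<in>half_lattice n. complex_of_real (bump n m k) * of_real (g k)) = of_real (g m)"
proof (rule infsumI, rule has_sum_finite_neutralI[of "{m}"])
  show "complex_of_real (bump n m k) * of_real (g k) = 0" if "k \<in> half_lattice n - {m}" for k
    using that m by (simp add: bump_half_lattice)
qed (use m in \<open>auto simp: bump_half_lattice\<close>)

section \<open>Occupation averages of the process\<close>

lemma sine_det_repeated:
  assumes "a < n" "b < n" "a \<noteq> b" "k a = k b"
  shows "sine_det n k = 0"
  unfolding sine_det_def
  by (rule det_identical_rows[of _ n a b]) (use assms in \<open>auto intro!: eq_vecI\<close>)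

lemma half_discrete_sine_processD:
  assumes "half_discrete_sine_process M w"
  shows "prob_space M"
    and "\<And>\<omega> K. \<omega> \<in> space M \<Longrightarrow> compact K \<Longrightarrow> finite {j. w \<omega> j \<in> K}"
    and "AE \<omega> in M. \<forall>j. w \<omega> j \<in> half_ints"
    and "\<And>n \<phi>. n \<ge> 1 \<Longrightarrow> \<phi> \<in> cc_space n \<Longrightarrow>
        has_bochner_integral M
          (\<lambda>\<omega>. \<Sum>\<^sub>\<infinity>j \<in> distinct_indices n. \<phi> (vec_of n (\<lambda>i. w \<omega> (j i))))
          ((1/2) ^ n * (\<Sum>\<^sub>\<infinity>k \<in> half_lattice n. \<phi> k * of_real (sine_det n k)))"
  using assms unfolding half_discrete_sine_process_def point_process_def by blast+

text \<open>
  The indicator of \<^const>\<open>occupied\<close> need not be measurable, as the labelling of the points is arbitrary;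
  the integrable function \<open>bump_sum\<close>, equal to it almost surely, replaces it under expectations.
\<close>

definition bump_sum :: "('a \<Rightarrow> int \<Rightarrow> real) \<Rightarrow> nat \<Rightarrow> (nat \<Rightarrow> real) \<Rightarrow> 'a \<Rightarrow> real" where
  "bump_sum w n m \<omega> =
     Re (\<Sum>\<^sub>\<infinity>j\<in>distinct_indices n. complex_of_real (bump n m (vec_of n (\<lambda>i. w \<omega> (j i)))))"

text \<open>This is the correlation identity for the tent at \<open>m\<close>, whose lattice sum
  collapses to the single term \<open>k = m\<close>.\<close>

lemma has_bochner_integral_bump_sum:
  assumes "half_discrete_sine_process M w" "n \<ge> 1" "m \<in> half_lattice n"
  shows "has_bochner_integral M (bump_sum w n m) ((1/2) ^ n * sine_det n m)"
proof -
  have "has_bochner_integral M (\<lambda>\<omega>. Re (\<Sum>\<^sub>\<infinity>j\<in>distinct_indices n.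
          complex_of_real (bump n m (vec_of n (\<lambda>i. w \<omega> (j i))))))
        (Re ((1/2) ^ n * (\<Sum>\<^sub>\<infinity>k\<in>half_lattice n. complex_of_real (bump n m k) * of_real (sine_det n k))))"
    by (intro has_bochner_integral_Re half_discrete_sine_processD(4)[OF assms(1)] assms(2)
          bump_in_cc_space)
  moreover have "Re ((1/2) ^ n * complex_of_real (sine_det n m)) = (1/2) ^ n * sine_det n m"
  proof -
    have "(1/2) ^ n * complex_of_real (sine_det n m) = of_real ((1/2) ^ n * sine_det n m)" by simp
    then show ?thesis by (simp only: Re_complex_of_real)
  qed
  ultimately show ?thesis
    unfolding infsum_bump_half_lattice[OF assms(3)] bump_sum_def[abs_def] by simp
qed

text \<open>The pattern \<open>(x, x)\<close> has a determinant with two equal rows, so its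
  nonnegative tent sum has expectation 0 and vanishes almost surely, whereas two labels at
  \<open>x\<close> would contribute a term 1. Only countably many sites \<open>x\<close> have to be
  treated.\<close>

lemma AE_inj_half_discrete_sine_process:
  assumes proc: "half_discrete_sine_process M w"
  shows "AE \<omega> in M. inj (w \<omega>)"
proof -
  note P = half_discrete_sine_processD[OF proc]
  have site: "AE \<omega> in M. \<forall>a b. w \<omega> a = x \<longrightarrow> w \<omega> b = x \<longrightarrow> a = b" if x: "x \<in> half_ints" for x
  proof -
    define m where "m = vec_of 2 (\<lambda>_. x)"
    let ?b = "\<lambda>\<omega> j. bump 2 m (vec_of 2 (\<lambda>i. w \<omega> (j i)))"
    have m: "m \<in> half_lattice 2" unfolding m_def by (intro vec_of_in_half_lattice x)
    have "sine_det 2 m = 0"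
      by (rule sine_det_repeated[of 0 _ 1]) (auto simp: m_def vec_of_def)
    then have hbi: "has_bochner_integral M (bump_sum w 2 m) 0"
      using has_bochner_integral_bump_sum[OF proc _ m] by simp
    \<comment> \<open>\<open>infsum\<close> is 0 by default on a family that is not summable, so a
      vanishing sum is informative only once summability is known. Injectivity is not yet available
      here; local finiteness leaves finitely many labels with points near \<open>x\<close>.\<close>
    have summ: "?b \<omega> summable_on distinct_indices 2" if \<omega>: "\<omega> \<in> space M" for \<omega>
    proof (rule finite_nonzero_values_imp_summable_on)
      have "{j \<in> distinct_indices 2. ?b \<omega> j \<noteq> 0} \<subseteq> PiE {..<2} (\<lambda>_. {a. w \<omega> a \<in> cball x 1})"
      proof
        fix j assume j: "j \<in> {j \<in> distinct_indices 2. ?b \<omega> j \<noteq> 0}"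
        have "w \<omega> (j i) \<in> cball x 1" if "i < 2" for i
        proof -
          have "\<bar>vec_of 2 (\<lambda>i. w \<omega> (j i)) i - m i\<bar> < 1/2" using j that by (intro bump_nonzeroD) auto
          then show ?thesis using that by (simp add: m_def vec_of_def dist_real_def abs_minus_commute)
        qed
        then show "j \<in> PiE {..<2} (\<lambda>_. {a. w \<omega> a \<in> cball x 1})"
          using j by (auto simp: distinct_indices_def PiE_iff)
      qed
      moreover have "finite (PiE {..<2::nat} (\<lambda>_. {a. w \<omega> a \<in> cball x 1}))"
        using P(2)[OF \<omega> compact_cball] by (intro finite_PiE) (auto simp del: mem_cball)
      ultimately show "finite {j \<in> distinct_indices 2. ?b \<omega> j \<noteq> 0}" by (rule finite_subset)
    qed
    have Re: "bump_sum w 2 m \<omega> = infsum (?b \<omega>) (distinct_indices 2)" if \<omega>: "\<omega> \<in> space M" for \<omega>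
      unfolding bump_sum_def
      using infsum_Re[of "\<lambda>j. complex_of_real (?b \<omega> j)"] summ[OF \<omega>] by (simp add: summable_on_of_real)
    have "AE \<omega> in M. 0 \<le> bump_sum w 2 m \<omega>"
      by (intro AE_I2) (auto simp: Re intro!: infsum_nonneg bump_nonneg)
    then have "AE \<omega> in M. bump_sum w 2 m \<omega> = 0"
      using hbi integral_nonneg_eq_0_iff_AE[of M "bump_sum w 2 m"]
      by (auto simp: has_bochner_integral_iff)
    then show ?thesis
      using AE_space
    proof eventually_elim
      case (elim \<omega>)
      show ?case
      proof (intro allI impI, rule ccontr)
        fix a b assume ab: "w \<omega> a = x" "w \<omega> b = x" "a \<noteq> b"
        define j where "j = (\<lambda>i\<in>{..<2::nat}. if i = 0 then a else b)"
        have j: "j \<in> distinct_indices 2"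
          using ab(3) by (auto simp: distinct_indices_def j_def inj_on_def split: if_splits)
        have "?b \<omega> j = 0"
          using elim Re summ[OF elim(2)] j
          by (intro nonneg_infsum_le_0D[of "?b \<omega>" "distinct_indices 2"] bump_nonneg) auto
        moreover have "vec_of 2 (\<lambda>i. w \<omega> (j i)) = m"
          using ab by (auto simp: m_def vec_of_def j_def)
        then have "?b \<omega> j = 1" by (simp add: bump_def)
        ultimately show False by simp
      qed
    qed
  qed
  have "countable half_ints" by (simp add: half_ints_def)
  then have "AE \<omega> in M. \<forall>x\<in>half_ints. \<forall>a b. w \<omega> a = x \<longrightarrow> w \<omega> b = x \<longrightarrow> a = b"
    using site by (intro AE_ball_countable') auto
  with P(3) show ?thesis by eventually_elim (auto simp: inj_def)
qed

lemma AE_bump_sum_eq_occupied: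
  assumes proc: "half_discrete_sine_process M w" and m: "m \<in> half_lattice n"
  shows "AE \<omega> in M. bump_sum w n m \<omega> = of_bool (occupied (w \<omega>) n m)"
  using AE_inj_half_discrete_sine_process[OF proc] half_discrete_sine_processD(3)[OF proc]
proof eventually_elim
  case (elim \<omega>)
  then show ?case using m by (simp add: bump_sum_def infsum_bump_occupied)
qed

text \<open>The shifts of the pattern have a common mean by \<open>sine_det_translate\<close>, and
  their covariances decay like the inverse of the shift difference, so the strong law applies to the
  centred tent sums.\<close>

lemma AE_averages_occupied:
  assumes proc: "half_discrete_sine_process M w" and n: "n \<ge> 1" and m: "m \<in> half_lattice n"
  shows "AE \<omega> in M. (\<lambda>N. (\<Sum>l<N. of_bool (occupied (w \<omega>) n (vec_of n (\<lambda>i. m i + real l / 2)))) / real N)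
           \<longlonglongrightarrow> (1/2) ^ n * sine_det n m"
proof -
  interpret prob_space M by (rule half_discrete_sine_processD(1)[OF proc])
  define k where "k l = vec_of n (\<lambda>i. m i + real l / 2)" for l :: nat
  define \<mu> where "\<mu> = (1/2) ^ n * sine_det n m"
  define X where "X l = bump_sum w n (k l)" for l
  have k: "k l \<in> half_lattice n" for l
    unfolding k_def using m
    by (intro vec_of_in_half_lattice half_ints_add_half_nat) (auto simp: half_lattice_def)
  have det_k: "sine_det n (k l) = sine_det n m" for l
    by (rule sine_det_translate[where c = "real l / 2"]) (auto simp: k_def vec_of_def)
  have X: "has_bochner_integral M (X l) \<mu>" for l
    using has_bochner_integral_bump_sum[OF proc n k] by (simp add: X_def \<mu>_def det_k)
  then have intX [simp]: "integrable M (X l)" and EX: "expectation (X l) = \<mu>" for l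
    by (auto simp: has_bochner_integral_iff)
  have [measurable]: "X l \<in> borel_measurable M" for l using intX[of l] by (rule borel_measurable_integrable)
  have occ: "AE \<omega> in M. X l \<omega> = of_bool (occupied (w \<omega>) n (k l))" for l
    unfolding X_def by (rule AE_bump_sum_eq_occupied[OF proc k])
  have bddX: "AE \<omega> in M. \<bar>X l \<omega>\<bar> \<le> 1" for l
    using occ[of l] by eventually_elim auto
  have bddXX: "AE \<omega> in M. \<bar>X i \<omega> * X j \<omega>\<bar> \<le> 1" for i j
    using bddX[of i] bddX[of j] by eventually_elim (auto simp: abs_mult intro: mult_le_one)
  have intXX: "integrable M (\<lambda>\<omega>. X i \<omega> * X j \<omega>)" for i j
    by (rule integrable_const_bound[where B = 1]) (use bddXX in auto)
  \<comment> \<open>An upper bound for the diameter of the pattern, increased by 1 so that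
    \<open>d \<ge> 4 * D\<close> forces \<open>d \<ge> 1\<close>.\<close>
  define D where "D = 1 + 2 * (\<Sum>a<n. \<bar>m a\<bar>)"
  have D: "\<bar>m a - m b\<bar> \<le> D" if "a < n" "b < n" for a b
    using member_le_sum[of a "{..<n}" "\<lambda>a. \<bar>m a\<bar>"] member_le_sum[of b "{..<n}" "\<lambda>a. \<bar>m a\<bar>"] that
    unfolding D_def by auto
  have D1: "D \<ge> 1" by (simp add: D_def sum_nonneg)
  define K :: real where "K = fact (n + n) * real (n + n)"
  have K0: "K \<ge> 0" by (simp add: K_def)
  \<comment> \<open>\<open>8 * K\<close> serves distant pairs, since
    \<open>4 * K / d \<le> 8 * K / (1 + d)\<close> for \<open>d \<ge> 1\<close>;
    \<open>1 + 4 * D\<close> serves pairs with \<open>d < 4 * D\<close>, whose covariance is at most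
    1.\<close>
  define C where "C = 8 * K + 1 + 4 * D"
  have cov: "expectation (\<lambda>\<omega>. X i \<omega> * X j \<omega>) - \<mu>\<^sup>2 \<le> C / (1 + \<bar>real i - real j\<bar>)" for i j
  proof -
    define d where "d = \<bar>real i - real j\<bar>"
    have d0: "d \<ge> 0" by (simp add: d_def)
    show ?thesis
    proof (cases "d \<ge> 4 * D")
      case True
      \<comment> \<open>The two patterns are shifted by \<open>d / 2\<close> relative to each other,
        and their extent costs at most \<open>D \<le> d / 4\<close>. In particular they share no
        site.\<close>
      have far: "\<bar>k i a - k j b\<bar> \<ge> d / 4" if "a < n" "b < n" for a b
      proof -
        have "k i a - k j b = (m a - m b) + (real i - real j) / 2"
          using that by (simp add: k_def vec_of_def diff_divide_distrib)
        then have "\<bar>(real i - real j) / 2\<bar> \<le> \<bar>k i a - k j b\<bar> + \<bar>m a - m b\<bar>"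
          using abs_triangle_ineq4[of "k i a - k j b" "m a - m b"] by simp
        moreover have "\<bar>(real i - real j) / 2\<bar> = d / 2" by (simp add: d_def)
        ultimately show ?thesis using D[OF that] True by linarith
      qed
      have dpos: "d \<ge> 1" using True D1 by linarith
      have S: "\<bar>S (k i a - k j b)\<bar> \<le> 4 / d" if "a < n" "b < n" for a b
      proof -
        have "k i a - k j b \<noteq> 0" using far[OF that] dpos by auto
        then have "\<bar>S (k i a - k j b)\<bar> \<le> 1 / \<bar>k i a - k j b\<bar>" by (rule abs_S_le_inverse)
        also have "\<dots> \<le> 1 / (d / 4)" using far[OF that] dpos by (intro frac_le) auto
        finally show ?thesis by simp
      qed
      let ?q = "concat_points n (k i) (k j)"
      have q: "?q \<in> half_lattice (n + n)" by (rule concat_points_in_half_lattice[OF k k])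
      \<comment> \<open>Joint occupation of disjoint patterns is occupation of the concatenated one,
        so its probability is again a determinant.\<close>
      have "AE \<omega> in M. X i \<omega> * X j \<omega> = bump_sum w (n + n) ?q \<omega>"
        using occ[of i] occ[of j] AE_bump_sum_eq_occupied[OF proc q]
          AE_inj_half_discrete_sine_process[OF proc]
      proof eventually_elim
        case (elim \<omega>)
        have "k i a \<noteq> k j b" if "a < n" "b < n" for a b
          using far[OF that] dpos by auto
        then show ?case
          using elim occupied_concat_points[OF elim(4) k k, of i j] by simp
      qed
      then have "expectation (\<lambda>\<omega>. X i \<omega> * X j \<omega>) = expectation (bump_sum w (n + n) ?q)"
        using has_bochner_integral_bump_sum[OF proc _ q] n intXX
        by (intro integral_cong_AE) (auto simp: has_bochner_integral_iff)
      also have "\<dots> = (1/2) ^ (n + n) * sine_det (n + n) ?q"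
        using has_bochner_integral_bump_sum[OF proc _ q] n by (auto simp: has_bochner_integral_iff)
      finally have "expectation (\<lambda>\<omega>. X i \<omega> * X j \<omega>) - \<mu>\<^sup>2
          = (1/2) ^ (n + n) * (sine_det (n + n) ?q - sine_det n (k i) * sine_det n (k j))"
        by (simp add: \<mu>_def det_k power_add power2_eq_square algebra_simps)
      also have "\<dots> \<le> (1/2) ^ (n + n) * (K * (4 / d))"
        using sine_det_concat_points[of n "k i" "k j" "4 / d"] S dpos
        by (intro mult_left_mono) (auto simp: K_def mult.assoc)
      also have "\<dots> \<le> 1 * (K * (4 / d))"
        using K0 dpos by (intro mult_right_mono power_le_one) auto
      also have "\<dots> \<le> 8 * K / (1 + d)"
      proof -
        have "K * d \<ge> K" using mult_left_mono[OF dpos K0] by simp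
        then show ?thesis using dpos by (simp add: field_simps)
      qed
      also have "\<dots> \<le> C / (1 + d)"
        using d0 D1 by (intro divide_right_mono) (auto simp: C_def)
      finally show ?thesis by (simp add: d_def)
    next
      case False
      have "expectation (\<lambda>\<omega>. X i \<omega> * X j \<omega>) \<le> expectation (\<lambda>\<omega>. 1)"
        using bddXX[of i j] intXX by (intro integral_mono_AE) (auto elim: eventually_mono)
      then have "expectation (\<lambda>\<omega>. X i \<omega> * X j \<omega>) - \<mu>\<^sup>2 \<le> 1"
        by (simp add: prob_space) (smt (verit) zero_le_power2)
      also have "1 \<le> C / (1 + d)"
        using False d0 K0 by (simp add: C_def le_divide_eq)
      finally show ?thesis by (simp add: d_def)
    qed
  qed
  have "AE \<omega> in M. (\<lambda>N. (\<Sum>l<N. X l \<omega> - \<mu>) / real N) \<longlonglongrightarrow> 0"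
  proof (rule strong_law_decaying_correlations[where B = "1 + \<bar>\<mu>\<bar>" and C = C])
    show "AE \<omega> in M. \<bar>X i \<omega> - \<mu>\<bar> \<le> 1 + \<bar>\<mu>\<bar>" for i
      using bddX[of i] by eventually_elim linarith
    show "expectation (\<lambda>\<omega>. (X i \<omega> - \<mu>) * (X j \<omega> - \<mu>)) \<le> C / (1 + \<bar>real i - real j\<bar>)" for i j
    proof -
      have "expectation (\<lambda>\<omega>. (X i \<omega> - \<mu>) * (X j \<omega> - \<mu>))
          = expectation (\<lambda>\<omega>. X i \<omega> * X j \<omega> - \<mu> * X i \<omega> - \<mu> * X j \<omega> + \<mu>\<^sup>2)"
        by (rule arg_cong[of _ _ expectation]) (auto simp: algebra_simps power2_eq_square)
      also have "\<dots> = expectation (\<lambda>\<omega>. X i \<omega> * X j \<omega>) - \<mu>\<^sup>2"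
        using intXX[of i j] by (simp add: EX prob_space power2_eq_square)
      finally show ?thesis using cov[of i j] by simp
    qed
  qed simp
  moreover have "AE \<omega> in M. \<forall>l. X l \<omega> = of_bool (occupied (w \<omega>) n (k l))"
    using occ by (simp add: AE_all_countable)
  ultimately show ?thesis
  proof eventually_elim
    case (elim \<omega>)
    have "(\<lambda>N. (\<Sum>l<N. X l \<omega> - \<mu>) / real N + \<mu>) \<longlonglongrightarrow> 0 + \<mu>"
      by (intro tendsto_intros elim)
    \<comment> \<open>The identity can fail at \<open>N = 0\<close>, where division by zero returns
      0 and the left side equals \<open>\<mu>\<close>.\<close>
    moreover have "eventually (\<lambda>N. (\<Sum>l<N. X l \<omega> - \<mu>) / real N + \<mu>
        = (\<Sum>l<N. of_bool (occupied (w \<omega>) n (k l))) / real N) sequentially"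
      using eventually_gt_at_top[of 0]
      by eventually_elim (use elim in \<open>simp add: sum_subtractf field_simps\<close>)
    ultimately show ?case
      unfolding k_def \<mu>_def by (auto dest: Lim_transform_eventually)
  qed
qed

section \<open>Schwartz functions on the lattice\<close>

text \<open>The domination makes all families absolutely summable, so their sums are integrals for
  the counting measure and Lebesgue's theorem applies.\<close>

lemma infsum_dominated_convergence:
  fixes f :: "nat \<Rightarrow> 'b \<Rightarrow> complex"
  assumes h: "h summable_on A"
    and dom: "\<And>n x. x \<in> A \<Longrightarrow> norm (f n x) \<le> h x"
    and lim: "\<And>x. x \<in> A \<Longrightarrow> (\<lambda>n. f n x) \<longlonglongrightarrow> g x"
  shows "(\<lambda>n. infsum (f n) A) \<longlonglongrightarrow> infsum g A"
proof -
  have h0: "h x \<ge> 0" if "x \<in> A" for x using dom[OF that, of 0] norm_ge_zero order_trans by blast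
  have g_le: "norm (g x) \<le> h x" if "x \<in> A" for x
    using tendsto_norm[OF lim[OF that]] dom[OF that] by (intro LIMSEQ_le_const2) auto
  have abs: "Infinite_Set_Sum.abs_summable_on F A" if "\<And>x. x \<in> A \<Longrightarrow> norm (F x) \<le> h x"
    for F :: "'b \<Rightarrow> complex"
    unfolding abs_summable_equivalent[symmetric]
    by (rule summable_on_comparison_test[OF h]) (use that in auto)
  have "(\<lambda>x. norm (h x)) summable_on A"
    using h h0 by (metis (mono_tags, lifting) real_norm_def abs_of_nonneg summable_on_cong)
  then have "integrable (count_space A) h"
    unfolding abs_summable_equivalent abs_summable_on_def .
  then have "(\<lambda>n. infsetsum (f n) A) \<longlonglongrightarrow> infsetsum g A"
    unfolding infsetsum_def
    by (intro integral_dominated_convergence[where w = h]) (auto simp: AE_count_space lim dom)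
  then show ?thesis
    using abs[OF dom] abs[OF g_le] by (simp add: infsetsum_infsum)
qed

lemma summable_on_half_ints: "(\<lambda>x. 1 / (1 + x\<^sup>2)) summable_on half_ints"
proof -
  have nat: "(\<lambda>n::nat. 1 / (1 + (real n / 2)\<^sup>2)) summable_on UNIV"
  proof (subst summable_on_UNIV_nonneg_real_iff)
    show "summable (\<lambda>n::nat. 1 / (1 + (real n / 2)\<^sup>2))"
    proof (rule summable_comparison_test_ev)
      show "summable (\<lambda>n. 4 * inverse (real n ^ 2))"
        by (intro summable_mult inverse_power_summable) simp
      show "eventually (\<lambda>n. norm (1 / (1 + (real n / 2)\<^sup>2)) \<le> 4 * inverse (real n ^ 2)) sequentially"
        using eventually_gt_at_top[of 0]
        by eventually_elim (simp add: field_simps power_divide add_nonneg_pos)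
    qed
  qed auto
  have pos: "(\<lambda>x. 1 / (1 + x\<^sup>2)) summable_on range (\<lambda>n::nat. c * (real n / 2))"
    if c: "c = 1 \<or> c = -1" for c :: real
  proof (subst summable_on_reindex)
    show "((\<lambda>x. 1 / (1 + x\<^sup>2)) \<circ> (\<lambda>n::nat. c * (real n / 2))) summable_on UNIV"
      using nat c by (auto simp: o_def)
  qed (use c in \<open>auto simp: inj_on_def\<close>)
  \<comment> \<open>The half-integers are two rays meeting at 0; removing the first ray from the
    second makes the union disjoint.\<close>
  have sub: "half_ints \<subseteq> range (\<lambda>n::nat. 1 * (real n / 2)) \<union>
      (range (\<lambda>n::nat. -1 * (real n / 2)) - range (\<lambda>n::nat. 1 * (real n / 2)))"
  proof
    fix x assume "x \<in> half_ints"
    then obtain m where m: "x = real_of_int m / 2" by (auto simp: half_ints_def)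
    have "x = 1 * (real (nat m) / 2) \<or> x = -1 * (real (nat (- m)) / 2)"
      by (cases "m \<ge> 0") (auto simp: m)
    then show "x \<in> range (\<lambda>n::nat. 1 * (real n / 2)) \<union>
      (range (\<lambda>n::nat. -1 * (real n / 2)) - range (\<lambda>n::nat. 1 * (real n / 2)))" by blast
  qed
  have "(\<lambda>x. 1 / (1 + x\<^sup>2)) summable_on (range (\<lambda>n::nat. 1 * (real n / 2)) \<union>
      (range (\<lambda>n::nat. -1 * (real n / 2)) - range (\<lambda>n::nat. 1 * (real n / 2))))"
    by (rule summable_on_Un_disjoint[OF pos[of 1] summable_on_subset_banach[OF pos[of "-1"]]]) auto
  from summable_on_subset_banach[OF this sub] show ?thesis .
qed

text \<open>A product of one-dimensional summable factors is summable over \<open>PiE\<close>. The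
  map \<open>vec_of n\<close> transports this to the lattice, replacing \<open>undefined\<close> by
  0 outside the first \<open>n\<close> coordinates.\<close>

lemma summable_on_half_lattice_prod:
  "(\<lambda>k. \<Prod>i<n. 1 / (1 + (k i)\<^sup>2)) summable_on half_lattice n"
proof -
  have abs: "Infinite_Set_Sum.abs_summable_on (\<lambda>x. 1 / (1 + x\<^sup>2) :: real) half_ints"
    unfolding abs_summable_equivalent[symmetric] using summable_on_half_ints by simp
  have "Infinite_Set_Sum.abs_summable_on (\<lambda>g. \<Prod>i<n. 1 / (1 + (g i)\<^sup>2) :: real)
          (PiE {..<n} (\<lambda>_. half_ints))"
    by (rule abs_summable_on_prod_PiE) (use abs in \<open>auto simp: half_ints_def\<close>)
  then have summ: "(\<lambda>g. \<Prod>i<n. 1 / (1 + (g i)\<^sup>2) :: real) summable_on (PiE {..<n} (\<lambda>_. half_ints))"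
    unfolding abs_summable_equivalent[symmetric] by (rule abs_summable_summable)
  have bij: "bij_betw (vec_of n) (PiE {..<n} (\<lambda>_. half_ints)) (half_lattice n)"
  proof (rule bij_betwI[where g = "\<lambda>k. restrict k {..<n}"])
    show "vec_of n \<in> (PiE {..<n} (\<lambda>_. half_ints)) \<rightarrow> half_lattice n"
      by (auto intro!: vec_of_in_half_lattice)
    show "(\<lambda>k. restrict k {..<n}) \<in> half_lattice n \<rightarrow> (PiE {..<n} (\<lambda>_. half_ints))"
      by (auto simp: half_lattice_def)
    show "restrict (vec_of n g) {..<n} = g" if "g \<in> (PiE {..<n} (\<lambda>_. half_ints))" for g
      using that by (intro ext) (auto simp: vec_of_def PiE_iff extensional_def restrict_def)
    show "vec_of n (restrict k {..<n}) = k" if "k \<in> half_lattice n" for k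
      using that by (auto simp: vec_of_def half_lattice_def topspace_Euclidean_space)
  qed
  show ?thesis
    using summ
    by (subst summable_on_reindex_bij_betw[OF bij, symmetric]) (simp add: vec_of_def)
qed

text \<open>Expanding the product of the factors \<open>1 + (x i)^2\<close> gives one squared
  monomial for each set \<open>X\<close> of coordinates. Each is controlled by the Schwartz seminorm
  with exponent 2 on \<open>X\<close>, 0 elsewhere, and no derivatives.\<close>

lemma schwartz_space_decay:
  assumes "\<phi> \<in> schwartz_space n"
  obtains C where "\<And>x. x \<in> topspace (Euclidean_space n) \<Longrightarrow> norm (\<phi> x) \<le> C * (\<Prod>i<n. 1 / (1 + (x i)\<^sup>2))"
proof -
  let ?E = "topspace (Euclidean_space n)"
  have "\<exists>c. \<forall>x\<in>?E. (\<Prod>i\<in>X. (x i)\<^sup>2) * norm (\<phi> x) \<le> c" if X: "X \<subseteq> {..<n}" for X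
  proof -
    have "bounded ((\<lambda>x. (\<Prod>i<n. x i ^ (if i \<in> X then 2 else 0)) *\<^sub>R iter_partial_deriv [] \<phi> x) ` ?E)"
      using assms unfolding schwartz_space_def
      by (auto elim!: allE[of _ "\<lambda>i. if i \<in> X then 2 else 0"])
    then obtain c where c: "\<And>x. x \<in> ?E \<Longrightarrow>
        norm ((\<Prod>i<n. x i ^ (if i \<in> X then 2 else 0)) *\<^sub>R \<phi> x) \<le> c"
      by (auto simp: bounded_iff iter_partial_deriv_def)
    have "(\<Prod>i<n. x i ^ (if i \<in> X then 2 else 0)) = (\<Prod>i\<in>X. (x i)\<^sup>2)" for x :: "nat \<Rightarrow> real"
      using X by (intro prod.mono_neutral_cong_right) auto
    then show ?thesis
      using c by (intro exI[of _ c]) (auto simp: prod_nonneg)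
  qed
  then obtain c where c: "\<And>X x. X \<subseteq> {..<n} \<Longrightarrow> x \<in> ?E \<Longrightarrow> (\<Prod>i\<in>X. (x i)\<^sup>2) * norm (\<phi> x) \<le> c X"
    by metis
  show thesis
  proof (rule that)
    fix x assume x: "x \<in> ?E"
    have "(\<Prod>i<n. (x i)\<^sup>2 + 1) * norm (\<phi> x) = (\<Sum>X\<in>Pow {..<n}. (\<Prod>i\<in>X. (x i)\<^sup>2) * norm (\<phi> x))"
      by (simp add: prod_add sum_distrib_right)
    also have "\<dots> \<le> (\<Sum>X\<in>Pow {..<n}. c X)"
      using c x by (intro sum_mono) auto
    finally have *: "(\<Prod>i<n. (x i)\<^sup>2 + 1) * norm (\<phi> x) \<le> (\<Sum>X\<in>Pow {..<n}. c X)" .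
    have "(\<Prod>i<n. (x i)\<^sup>2 + 1) > 0" by (intro prod_pos) (auto intro: add_nonneg_pos)
    with * show "norm (\<phi> x) \<le> (\<Sum>X\<in>Pow {..<n}. c X) * (\<Prod>i<n. 1 / (1 + (x i)\<^sup>2))"
      by (simp add: prod_dividef field_simps)
  qed
qed

lemma schwartz_summable_on_half_lattice:
  assumes "\<phi> \<in> schwartz_space n"
  shows "(\<lambda>k. norm (\<phi> k)) summable_on half_lattice n"
proof -
  obtain C where C: "\<And>x. x \<in> topspace (Euclidean_space n) \<Longrightarrow>
      norm (\<phi> x) \<le> C * (\<Prod>i<n. 1 / (1 + (x i)\<^sup>2))"
    using schwartz_space_decay[OF assms] by blast
  show ?thesis
    by (rule summable_on_comparison_test[OF summable_on_cmult_right[OF summable_on_half_lattice_prod]])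
       (auto intro: C half_lattice_topspace)
qed

text \<open>The substitution \<open>k = w_j - l/2\<close> turns each shifted sum into a sum of
  \<open>\<phi> k\<close> over the whole lattice, weighted by the indicator that
  \<open>k + l/2\<close> is occupied. Averaging over \<open>l\<close> acts on the weights alone,
  which converge pointwise and stay bounded by 1.\<close>

lemma configuration_averages:
  fixes w :: "int \<Rightarrow> real"
  assumes inj: "inj w" and half: "\<And>j. w j \<in> half_ints"
    and avg: "\<And>m. m \<in> half_lattice n \<Longrightarrow>
      (\<lambda>N. (\<Sum>l<N. of_bool (occupied w n (vec_of n (\<lambda>i. m i + real l / 2)))) / real N)
        \<longlonglongrightarrow> (1/2) ^ n * sine_det n m"
    and \<phi>: "\<phi> \<in> schwartz_space n"
  shows "(\<lambda>j. \<phi> (vec_of n (\<lambda>i. w (j i) - real l / 2))) summable_on distinct_indices n"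
    and "(\<lambda>k. \<phi> k * of_real (sine_det n k)) summable_on half_lattice n"
    and "(\<lambda>N::nat. 1 / of_nat N *
        (\<Sum>l<N. \<Sum>\<^sub>\<infinity>j \<in> distinct_indices n. \<phi> (vec_of n (\<lambda>i. w (j i) - real l / 2))))
      \<longlonglongrightarrow> (1/2) ^ n * (\<Sum>\<^sub>\<infinity>k \<in> half_lattice n. \<phi> k * of_real (sine_det n k))"
proof -
  define v where "v l = (\<lambda>j. vec_of n (\<lambda>i. w (j i) - real l / 2))" for l :: nat
  define q where "q l k = (of_bool (occupied w n (vec_of n (\<lambda>i. k i + real l / 2))) :: real)"
    for l :: nat and k :: "nat \<Rightarrow> real"
  note norm_summ = schwartz_summable_on_half_lattice[OF \<phi>]
  have bounded_mult: "(\<lambda>k. \<phi> k * of_real (c k)) summable_on half_lattice n"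
    if "\<And>k. k \<in> half_lattice n \<Longrightarrow> \<bar>c k\<bar> \<le> B" for c B
  proof (rule abs_summable_summable, rule summable_on_comparison_test)
    show "(\<lambda>k. B * norm (\<phi> k)) summable_on half_lattice n"
      by (intro summable_on_cmult_right norm_summ)
    show "norm (\<phi> k * of_real (c k)) \<le> B * norm (\<phi> k)" if "k \<in> half_lattice n" for k
      using mult_right_mono[OF \<open>\<And>k. k \<in> half_lattice n \<Longrightarrow> \<bar>c k\<bar> \<le> B\<close>[OF that], of "norm (\<phi> k)"]
      by (simp add: norm_mult mult.commute)
  qed auto
  have inj_v: "inj_on (v l) (distinct_indices n)" for l
    using inj_on_vec_of_distinct_indices[OF inj, of n "- (real l / 2)"] by (simp add: v_def)
  have v_sub: "v l ` distinct_indices n \<subseteq> half_lattice n" for l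
    unfolding v_def using half by (auto intro!: vec_of_in_half_lattice half_ints_diff_half_nat)
  have v_iff: "k \<in> v l ` distinct_indices n \<longleftrightarrow> occupied w n (vec_of n (\<lambda>i. k i + real l / 2))"
    if k: "k \<in> half_lattice n" for k l
  proof -
    have "k = v l j \<longleftrightarrow> vec_of n (\<lambda>i. w (j i)) = vec_of n (\<lambda>i. k i + real l / 2)" for j
      using half_lattice_topspace[OF k]
      by (auto simp: v_def vec_of_def fun_eq_iff topspace_Euclidean_space)
    then show ?thesis by (auto simp: occupied_def)
  qed
  have \<phi>_summ: "\<phi> summable_on half_lattice n" by (rule abs_summable_summable[OF norm_summ])
  have summ_v: "\<phi> summable_on v l ` distinct_indices n" for l
    by (rule summable_on_subset_banach[OF \<phi>_summ v_sub])
  show "(\<lambda>j. \<phi> (vec_of n (\<lambda>i. w (j i) - real l / 2))) summable_on distinct_indices n"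
    using summ_v[of l] unfolding summable_on_reindex[OF inj_v] by (simp add: o_def v_def)
  have shifted: "((\<lambda>k. \<phi> k * of_real (q l k)) has_sum
      (\<Sum>\<^sub>\<infinity>j \<in> distinct_indices n. \<phi> (vec_of n (\<lambda>i. w (j i) - real l / 2)))) (half_lattice n)" for l
  proof -
    have "(\<Sum>\<^sub>\<infinity>j \<in> distinct_indices n. \<phi> (vec_of n (\<lambda>i. w (j i) - real l / 2)))
        = infsum \<phi> (v l ` distinct_indices n)"
      by (subst infsum_reindex[OF inj_v]) (simp add: o_def v_def)
    also have "\<dots> = (\<Sum>\<^sub>\<infinity>k\<in>half_lattice n. \<phi> k * of_real (q l k))"
    proof (rule infsum_cong_neutral)
      have q: "q l k = of_bool (k \<in> v l ` distinct_indices n)" if "k \<in> half_lattice n" for k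
        using v_iff[OF that] by (simp add: q_def)
      show "\<phi> k * of_real (q l k) = 0" if "k \<in> half_lattice n - v l ` distinct_indices n" for k
        using q that by simp
      show "\<phi> k = 0" if "k \<in> v l ` distinct_indices n - half_lattice n" for k
        using v_sub that by blast
      show "\<phi> k = \<phi> k * of_real (q l k)" if "k \<in> v l ` distinct_indices n \<inter> half_lattice n" for k
        using q that by simp
    qed
    finally show ?thesis
      using bounded_mult[of "q l" 1] by (simp add: q_def)
  qed
  define A where "A N k = (\<Sum>l<N. q l k) / real N" for N k
  have A_le: "\<bar>A N k\<bar> \<le> 1" for N k
  proof -
    have "0 \<le> (\<Sum>l<N. q l k)" by (intro sum_nonneg) (simp add: q_def)
    moreover have "(\<Sum>l<N. q l k) \<le> (\<Sum>l<N. 1)" by (intro sum_mono) (simp add: q_def)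
    ultimately show ?thesis by (simp add: A_def divide_le_eq)
  qed
  have A_lim: "(\<lambda>N. A N k) \<longlonglongrightarrow> (1/2) ^ n * sine_det n k" if "k \<in> half_lattice n" for k
    using avg[OF that] by (simp add: A_def q_def)
  \<comment> \<open>The determinants inherit a uniform bound from being limits of occupation
    averages, and this bound gives summability of the right-hand side.\<close>
  have "\<bar>(1/2) ^ n * sine_det n k\<bar> \<le> 1" if "k \<in> half_lattice n" for k
    using tendsto_rabs[OF A_lim[OF that]] A_le by (intro LIMSEQ_le_const2) auto
  then have "\<bar>sine_det n k\<bar> \<le> 2 ^ n" if "k \<in> half_lattice n" for k
    using that by (simp add: abs_mult power_divide divide_le_eq)
  then show "(\<lambda>k. \<phi> k * of_real (sine_det n k)) summable_on half_lattice n"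
    by (rule bounded_mult)
  \<comment> \<open>Only finitely many \<open>l\<close> occur, so the sums may be interchanged; at
    \<open>N = 0\<close> both sides are 0.\<close>
  have eq: "1 / of_nat N * (\<Sum>l<N. \<Sum>\<^sub>\<infinity>j \<in> distinct_indices n. \<phi> (vec_of n (\<lambda>i. w (j i) - real l / 2)))
      = (\<Sum>\<^sub>\<infinity>k\<in>half_lattice n. \<phi> k * of_real (A N k))" for N
  proof -
    have "((\<lambda>k. 1 / of_nat N * (\<Sum>l<N. \<phi> k * of_real (q l k))) has_sum 1 / of_nat N *
        (\<Sum>l<N. \<Sum>\<^sub>\<infinity>j \<in> distinct_indices n. \<phi> (vec_of n (\<lambda>i. w (j i) - real l / 2)))) (half_lattice n)"
    proof (intro has_sum_cmult_right)
      show "((\<lambda>k. \<Sum>l<N. \<phi> k * of_real (q l k)) has_sum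
        (\<Sum>l<N. \<Sum>\<^sub>\<infinity>j \<in> distinct_indices n. \<phi> (vec_of n (\<lambda>i. w (j i) - real l / 2)))) (half_lattice n)"
        by (induction N) (auto intro!: has_sum_add shifted)
    qed
    moreover have "1 / of_nat N * (\<Sum>l<N. \<phi> k * of_real (q l k)) = \<phi> k * of_real (A N k)" for k
      by (simp add: A_def sum_distrib_left sum_divide_distrib)
    ultimately show ?thesis by (simp add: infsumI)
  qed
  have "(\<lambda>N. \<Sum>\<^sub>\<infinity>k\<in>half_lattice n. \<phi> k * of_real (A N k)) \<longlonglongrightarrow>
      (\<Sum>\<^sub>\<infinity>k\<in>half_lattice n. \<phi> k * of_real ((1/2) ^ n * sine_det n k))"
  proof (rule infsum_dominated_convergence[OF norm_summ])
    show "norm (\<phi> k * of_real (A N k)) \<le> norm (\<phi> k)" for N k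
      using mult_left_mono[OF A_le, of "norm (\<phi> k)" N k] by (simp add: norm_mult)
    show "(\<lambda>N. \<phi> k * of_real (A N k)) \<longlonglongrightarrow> \<phi> k * of_real ((1/2) ^ n * sine_det n k)"
      if "k \<in> half_lattice n" for k
      by (intro tendsto_intros A_lim that)
  qed
  also have "(\<Sum>\<^sub>\<infinity>k\<in>half_lattice n. \<phi> k * of_real ((1/2) ^ n * sine_det n k))
      = (\<Sum>\<^sub>\<infinity>k\<in>half_lattice n. (1/2) ^ n * (\<phi> k * of_real (sine_det n k)))"
    by (intro infsum_cong) simp
  also have "\<dots> = (1/2) ^ n * (\<Sum>\<^sub>\<infinity>k \<in> half_lattice n. \<phi> k * of_real (sine_det n k))"
    by (rule infsum_cmult_right')
  finally show "(\<lambda>N::nat. 1 / of_nat N *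
        (\<Sum>l<N. \<Sum>\<^sub>\<infinity>j \<in> distinct_indices n. \<phi> (vec_of n (\<lambda>i. w (j i) - real l / 2))))
      \<longlonglongrightarrow> (1/2) ^ n * (\<Sum>\<^sub>\<infinity>k \<in> half_lattice n. \<phi> k * of_real (sine_det n k))"
    unfolding eq .
qed

section \<open>The almost sure limit for all dimensions and test functions\<close>

theorem theorem5p3:
  fixes M :: "'a measure" and w :: "'a \<Rightarrow> int \<Rightarrow> real"
  assumes "half_discrete_sine_process M w"
  shows "AE \<omega> in M. \<forall>n\<ge>1. \<forall>\<phi> \<in> schwartz_space n.
    (\<forall>l::nat. (\<lambda>j. \<phi> (vec_of n (\<lambda>i. w \<omega> (j i) - real l / 2))) summable_on distinct_indices n) \<and>
    (\<lambda>k. \<phi> k * of_real (sine_det n k)) summable_on half_lattice n \<and>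
    (\<lambda>N::nat. 1 / of_nat N *
        (\<Sum>l<N. \<Sum>\<^sub>\<infinity>j \<in> distinct_indices n. \<phi> (vec_of n (\<lambda>i. w \<omega> (j i) - real l / 2))))
      \<longlonglongrightarrow> (1/2) ^ n * (\<Sum>\<^sub>\<infinity>k \<in> half_lattice n. \<phi> k * of_real (sine_det n k))"
proof -
  \<comment> \<open>The exceptional set is fixed here, over countably many \<open>n\<close> and
    \<open>m\<close>. Test functions enter only afterwards, for a single fixed configuration, so
    their uncountable number does no harm.\<close>
  have "AE \<omega> in M. \<forall>n\<in>{1..}. \<forall>m\<in>half_lattice n.
      (\<lambda>N. (\<Sum>l<N. of_bool (occupied (w \<omega>) n (vec_of n (\<lambda>i. m i + real l / 2)))) / real N)
        \<longlonglongrightarrow> (1/2) ^ n * sine_det n m"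
    by (intro AE_ball_countable' countable_half_lattice AE_averages_occupied[OF assms]) auto
  with AE_inj_half_discrete_sine_process[OF assms] half_discrete_sine_processD(3)[OF assms]
  show ?thesis
  proof eventually_elim
    case (elim \<omega>)
    show ?case
      using elim by (intro allI impI ballI conjI configuration_averages) auto
  qed
qed

end
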